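(* Let $A$ be a finite totally ordered set. The quiver map $\varphi:\mathbb{Z}Q(A)\to\mathbb{Z}\mathrm{Styl}(A)$ is surjective.
   Context: $A$ is a finite totally ordered set, whose elements are called letters, and $A^*$ is the free monoid on $A$. A column on $A$ is a subset of $A$ (also viewed as the word in $A^*$ that is the strictly decreasing product of its elements); $\Gamma(A)$ is the set of columns. Left action of $A^*$ on $\Gamma(A)$: for a letter $a$ and a column $\gamma$, if $a>y$ for all $y\in\gamma$, then $a\cdot\gamma=\gamma\cup\{a\}$; otherwise $a\cdot\gamma=(\gamma\setminus\{y\})\cup\{a\}$, where $y$ is the smallest element of $\gamma$ with $y\ge a$. This extends to words by $(uv)\cdot\gamma=u\cdot(v\cdot\gamma)$. The stylic monoid $\mathrm{Styl}(A)$ is the monoid (under composition) of the functions $\mu_w:\Gamma(A)\to\Gamma(A)$, $\gamma\mapsto w\cdot\gamma$, for $w\in A^*$; $\mathbb{Z}\mathrm{Styl}(A)$ is its monoid algebra over $\mathbb{Z}$. A letter or word is identified with its image $\mu_w$ when computing in this algebra. For $\gamma\in\Gamma(A)$, $$e_\gamma=\prod^{\nearrow}_{a\in A\setminus\gamma}(1-a)\ \prod^{\searrow}_{a\in\gamma}a\ \in\mathbb{Z}\mathrm{Styl}(A),$$ where the first product is taken in increasing order of letters and the second in decreasing order. Right action of $A^*$ on $\Gamma(A)$: for a column $\gamma$ and a letter $c$, if $c<x$ for all $x\in\gamma$ (in particular if $\gamma=\emptyset$), then $\gamma\cdot c=\gamma\cup\{c\}$; otherwise $\gamma\cdot c=(\gamma\setminus\{b\})\cup\{c\}$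 with $b=\max\{x\in\gamma:x\le c\}$. The right action of $c$ on $\gamma$ is called frank if $\gamma\ne\emptyset$, $c\ge\min(\gamma)$ and $c\notin\gamma$. The quiver $Q(A)$ has vertex set $\Gamma(A)$, and has a labelled edge $\gamma\xrightarrow{c}\gamma'$ whenever $\gamma\cdot c=\gamma'$ and this action is frank. The path algebra $\mathbb{Z}Q(A)$ is the free $\mathbb{Z}$-module on the paths of $Q(A)$ (including an empty path at each vertex $\gamma$, denoted $\gamma$), with product given by concatenation of paths, read from left to right, and $0$ for non-composable paths. The map $\varphi:\mathbb{Z}Q(A)\to\mathbb{Z}\mathrm{Styl}(A)$ is the $\mathbb{Z}$-algebra homomorphism sending the empty path $\gamma$ to $e_\gamma$ and a path $\gamma_0\xrightarrow{c_1}\gamma_1\xrightarrow{c_2}\cdots\xrightarrow{c_l}\gamma_l$ to $e_{\gamma_0}c_1e_{\gamma_1}c_2\cdots c_le_{\gamma_l}$. *)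

theory Defs
  imports "HOL-Library.Poly_Mapping" "HOL-Library.FuncSet" "HOL-Algebra.Ring"
begin

text \<open>
  The alphabet is a finite subset \<open>A\<close> of a linearly ordered type, so that the empty alphabet is
  covered too. Free \<open>\<int>\<close>-modules are rendered by finitely supported functions \<open>_ \<Rightarrow>\<^sub>0 int\<close>;
  \<open>frag_of\<close> is the basis vector and \<open>frag_extend\<close> the linear extension.
\<close>

definition prod_list_ring :: "('r, 'm) monoid_scheme \<Rightarrow> 'r list \<Rightarrow> 'r" where
  "prod_list_ring R xs = foldr (\<lambda>x y. x \<otimes>\<^bsub>R\<^esub> y) xs \<one>\<^bsub>R\<^esub>"

definition monoid_algebra :: "('m, 'k) monoid_scheme \<Rightarrow> ('m \<Rightarrow>\<^sub>0 int) ring" where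
  "monoid_algebra M =
    \<lparr>carrier = {x. Poly_Mapping.keys x \<subseteq> carrier M},
     mult = (\<lambda>x y. frag_extend (\<lambda>u. frag_extend (\<lambda>v. frag_of (u \<otimes>\<^bsub>M\<^esub> v)) y) x),
     one = frag_of \<one>\<^bsub>M\<^esub>,
     zero = 0,
     add = (+)\<rparr>"

section \<open>The stylic monoid\<close>

definition columns :: "'a set \<Rightarrow> 'a set set" where
  "columns A = Pow A"

definition left_act :: "'a::linorder \<Rightarrow> 'a set \<Rightarrow> 'a set" where
  "left_act a \<gamma> =
    (if \<forall>y\<in>\<gamma>. y < a then \<gamma> \<union> {a} else (\<gamma> - {Min {y\<in>\<gamma>. a \<le> y}}) \<union> {a})"

text \<open>The last letter of a word acts first, as in \<open>(uv) \<cdot> \<gamma> = u \<cdot> (v \<cdot> \<gamma>)\<close>. Functions on the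
  columns are made extensional with \<open>restrict\<close>, so that HOL equality of them is equality of maps
  on \<open>columns A\<close>.\<close>

definition styl_fun :: "'a::linorder set \<Rightarrow> 'a list \<Rightarrow> 'a set \<Rightarrow> 'a set" where
  "styl_fun A w = (\<lambda>\<gamma>\<in>columns A. foldr left_act w \<gamma>)"

definition Styl :: "'a::linorder set \<Rightarrow> ('a set \<Rightarrow> 'a set) monoid" where
  "Styl A =
    \<lparr>carrier = styl_fun A ` lists A,
     mult = compose (columns A),
     one = (\<lambda>\<gamma>\<in>columns A. \<gamma>)\<rparr>"

definition ZStyl :: "'a::linorder set \<Rightarrow> (('a set \<Rightarrow> 'a set) \<Rightarrow>\<^sub>0 int) ring" where
  "ZStyl A = monoid_algebra (Styl A)"

definition letter :: "'a::linorder set \<Rightarrow> 'a \<Rightarrow> ('a set \<Rightarrow> 'a set) \<Rightarrow>\<^sub>0 int" where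
  "letter A a = frag_of (styl_fun A [a])"

definition col_elt :: "'a::linorder set \<Rightarrow> 'a set \<Rightarrow> ('a set \<Rightarrow> 'a set) \<Rightarrow>\<^sub>0 int" where
  "col_elt A \<gamma> =
    prod_list_ring (ZStyl A)
      (map (\<lambda>a. \<one>\<^bsub>ZStyl A\<^esub> - letter A a) (sorted_list_of_set (A - \<gamma>)))
    \<otimes>\<^bsub>ZStyl A\<^esub>
    prod_list_ring (ZStyl A) (map (letter A) (rev (sorted_list_of_set \<gamma>)))"

section \<open>The quiver and its path algebra\<close>

definition right_act :: "'a::linorder set \<Rightarrow> 'a \<Rightarrow> 'a set" where
  "right_act \<gamma> c =
    (if \<forall>x\<in>\<gamma>. c < x then \<gamma> \<union> {c} else (\<gamma> - {Max {x\<in>\<gamma>. x \<le> c}}) \<union> {c})"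

definition frank :: "'a::linorder set \<Rightarrow> 'a \<Rightarrow> bool" where
  "frank \<gamma> c \<longleftrightarrow> \<gamma> \<noteq> {} \<and> Min \<gamma> \<le> c \<and> c \<notin> \<gamma>"

text \<open>An edge is a triple (source, label, target), a path a pair of its start vertex and its list
  of edges, so that there is one empty path for each vertex.\<close>

type_synonym ('v, 'l) edge = "'v \<times> 'l \<times> 'v"
type_synonym ('v, 'l) path = "'v \<times> ('v, 'l) edge list"

fun is_walk :: "('v, 'l) edge set \<Rightarrow> 'v \<Rightarrow> ('v, 'l) edge list \<Rightarrow> bool" where
  "is_walk E v [] \<longleftrightarrow> True"
| "is_walk E v ((s, c, t) # es) \<longleftrightarrow> s = v \<and> (s, c, t) \<in> E \<and> is_walk E t es"

definition paths :: "'v set \<Rightarrow> ('v, 'l) edge set \<Rightarrow> ('v, 'l) path set" where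
  "paths V E = {(v, es). v \<in> V \<and> is_walk E v es}"

fun path_end :: "('v, 'l) path \<Rightarrow> 'v" where
  "path_end (v, []) = v"
| "path_end (v, (s, c, t) # es) = path_end (t, es)"

definition path_mult :: "('v, 'l) path \<Rightarrow> ('v, 'l) path \<Rightarrow> ('v, 'l) path \<Rightarrow>\<^sub>0 int" where
  "path_mult p q = (if path_end p = fst q then frag_of (fst p, snd p @ snd q) else 0)"

definition path_algebra :: "'v set \<Rightarrow> ('v, 'l) edge set \<Rightarrow> (('v, 'l) path \<Rightarrow>\<^sub>0 int) ring" where
  "path_algebra V E =
    \<lparr>carrier = {x. Poly_Mapping.keys x \<subseteq> paths V E},
     mult = (\<lambda>x y. frag_extend (\<lambda>p. frag_extend (\<lambda>q. path_mult p q) y) x),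
     one = (\<Sum>v\<in>V. frag_of (v, [])),
     zero = 0,
     add = (+)\<rparr>"

definition quiver_edges :: "'a::linorder set \<Rightarrow> ('a set, 'a) edge set" where
  "quiver_edges A =
    {(\<gamma>, c, \<gamma>'). \<gamma> \<in> columns A \<and> c \<in> A \<and> frank \<gamma> c \<and> \<gamma>' = right_act \<gamma> c}"

definition ZQ :: "'a::linorder set \<Rightarrow> (('a set, 'a) path \<Rightarrow>\<^sub>0 int) ring" where
  "ZQ A = path_algebra (columns A) (quiver_edges A)"

section \<open>The quiver map\<close>

fun quiver_map_walk ::
  "'a::linorder set \<Rightarrow> 'a set \<Rightarrow> ('a set, 'a) edge list \<Rightarrow> ('a set \<Rightarrow> 'a set) \<Rightarrow>\<^sub>0 int" where
  "quiver_map_walk A \<gamma> [] = col_elt A \<gamma>"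
| "quiver_map_walk A \<gamma> ((s, c, t) # es) =
    col_elt A \<gamma> \<otimes>\<^bsub>ZStyl A\<^esub> (letter A c \<otimes>\<^bsub>ZStyl A\<^esub> quiver_map_walk A t es)"

text \<open>An algebra homomorphism on a path algebra is in particular \<open>\<int>\<close>-linear, hence it is the linear
  extension of its values on the paths.\<close>

definition quiver_map ::
  "'a::linorder set \<Rightarrow> (('a set, 'a) path \<Rightarrow>\<^sub>0 int) \<Rightarrow> (('a set \<Rightarrow> 'a set) \<Rightarrow>\<^sub>0 int)" where
  "quiver_map A = frag_extend (\<lambda>(\<gamma>, es). quiver_map_walk A \<gamma> es)"

end

theory Submission
  imports Defs
begin

text \<open>
  For a column \<open>\<gamma>\<close> let \<open>P\<^sub>\<gamma>\<close> be the increasing product of the \<open>1 - a\<close> with \<open>a \<in> A - \<gamma>\<close>, so that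
  \<open>e\<^sub>\<gamma> = P\<^sub>\<gamma> \<gamma>\<close>, where \<open>\<gamma>\<close> also stands for its decreasing word. Three facts carry the proof.

  \<^item> The \<open>e\<^sub>\<gamma>\<close> sum to \<open>1\<close> (\<open>sum_col_elt\<close>): if two columns differ only by the largest letter \<open>n\<close>, their
    products differ only in the middle factors \<open>1 - n\<close> and \<open>n\<close>, which add up to \<open>1\<close>; induct.
  \<^item> \<open>P\<^sub>\<gamma> w = 0\<close> as soon as the column \<open>w \<cdot> \<emptyset>\<close> is not contained in \<open>\<gamma>\<close>, in particular if it has more
    elements than \<open>\<gamma>\<close> (\<open>prefix_word_eq_0\<close>). Indeed, the action is monotone for inclusion and letters
    fix the columns that contain them, so a letter \<open>a \<in> w \<cdot> \<emptyset>\<close> satisfies \<open>a w = w\<close> in the stylic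
    monoid. The relation \<open>a b a = b a\<close> for \<open>a < b\<close> lets \<open>a\<close> travel through the factors of \<open>P\<^sub>\<gamma>\<close> to the
    right of \<open>1 - a\<close>, and \<open>(1 - a) a = 0\<close>.
  \<^item> \<open>e\<^sub>\<gamma> c\<close> equals \<open>e\<^sub>\<gamma>\<close> if \<open>c \<in> \<gamma>\<close>, vanishes if \<open>c\<close> is smaller than all elements of \<open>\<gamma>\<close>, and
    equals \<open>e\<^sub>\<gamma> c e\<^sub>\<delta>\<close> with \<open>\<delta> = \<gamma> \<cdot> c\<close> in the remaining, frank, case. The frank case is the core
    (\<open>col_elt_frank\<close>). The Knuth relations give \<open>\<gamma> c = b \<delta>\<close>, where \<open>b\<close> is the letter that \<open>c\<close>
    expels. Expanding \<open>P\<^sub>\<delta>\<close> in \<open>P\<^sub>\<gamma> b \<delta> P\<^sub>\<delta> \<delta>\<close> yields \<open>P\<^sub>\<gamma> b \<delta> \<delta> = P\<^sub>\<gamma> b \<delta>\<close> and further terms containing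
    a word \<open>b \<delta> v a \<delta>\<close> with \<open>a \<notin> \<delta>\<close>. Such a word sends \<open>\<emptyset>\<close> to a column with more than \<open>|\<delta>| = |\<gamma>|\<close>
    elements (\<open>card_act_sandwich\<close>), so these terms vanish by the second fact.

  By induction on a word \<open>w\<close>, the third fact shows that \<open>e\<^sub>\<gamma> w\<close> is \<open>0\<close> or the value of a path that starts
  at \<open>\<gamma>\<close>; summing over \<open>\<gamma>\<close>, every \<open>w\<close> lies in the image of the quiver map.
\<close>

section \<open>The left action of letters and words\<close>

lemma left_act_above:
  "(\<And>s. s \<in> S \<Longrightarrow> s < a) \<Longrightarrow> left_act a S = insert a S"
  by (simp add: left_act_def)

lemma left_act_bump:
  assumes "finite S" "p \<in> S" "a \<le> p" "\<And>s. s \<in> S \<Longrightarrow> a \<le> s \<Longrightarrow> p \<le> s"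
  shows "left_act a S = insert a (S - {p})"
proof -
  have "Min {y \<in> S. a \<le> y} = p"
    using assms by (intro Min_eqI) auto
  moreover have "\<not> (\<forall>y\<in>S. y < a)" using assms by force
  ultimately show ?thesis unfolding left_act_def by auto
qed

lemma left_act_cases:
  assumes "finite S"
  obtains (above) "\<forall>s\<in>S. s < a" "left_act a S = insert a S"
  | (bump) p where "p \<in> S" "a \<le> p" "\<forall>s\<in>S. a \<le> s \<longrightarrow> p \<le> s" "left_act a S = insert a (S - {p})"
proof (cases "\<forall>s\<in>S. s < a")
  case True
  then show ?thesis by (intro above left_act_above) auto
next
  case False
  define p where "p = Min {y \<in> S. a \<le> y}"
  have fin: "finite {y \<in> S. a \<le> y}" and ne: "{y \<in> S. a \<le> y} \<noteq> {}"
    using assms False by auto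
  have p: "p \<in> S" "a \<le> p" "\<forall>s\<in>S. a \<le> s \<longrightarrow> p \<le> s"
    using Min_in[OF fin ne] fin by (auto simp: p_def)
  then show ?thesis using left_act_bump[OF assms] by (intro bump[of p]) auto
qed

lemma finite_left_act [simp]: "finite S \<Longrightarrow> finite (left_act a S)"
  by (simp add: left_act_def)

lemma mem_left_act [simp]: "a \<in> left_act a S"
  by (simp add: left_act_def)

lemma left_act_fixed:
  assumes "finite S" "a \<in> S" shows "left_act a S = S"
  using left_act_bump[of S a a] assms by auto

lemma mem_left_act_iff:
  assumes "finite S"
  shows "t \<in> left_act a S \<longleftrightarrow> t = a \<or> t \<in> S \<and> (t < a \<or> (\<exists>s\<in>S. a \<le> s \<and> s < t))"
  using assms by (cases rule: left_act_cases[of S a]) force+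

lemma left_act_mono:
  assumes "finite T" "S \<subseteq> T"
  shows "left_act a S \<subseteq> left_act a T"
proof -
  have "finite S" using assms finite_subset by blast
  then show ?thesis using assms by (simp add: mem_left_act_iff subset_iff) blast
qed

text \<open>
  If \<open>S\<close> has an element in the half-open interval from \<open>x\<close> to \<open>z\<close>, the letter \<open>x\<close> only affects
  elements below \<open>z\<close>, and the letter \<open>z\<close> only elements from \<open>z\<close> on.
\<close>

lemma left_act_commute:
  assumes S: "finite S" "s \<in> S" and s: "x \<le> s" "s < z"
  shows "left_act x (left_act z S) = left_act z (left_act x S)"
proof -
  obtain p where p: "p \<in> S" "x \<le> p" "\<forall>s\<in>S. x \<le> s \<longrightarrow> p \<le> s"
    and x: "left_act x S = insert x (S - {p})"
    using S s by (cases rule: left_act_cases[of S x]) auto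
  have "p < z" using p S s by force
  show ?thesis using \<open>finite S\<close>
  proof (cases rule: left_act_cases[of S z])
    case above
    have "left_act z (insert x (S - {p})) = insert z (insert x (S - {p}))"
      using above s by (intro left_act_above) auto
    moreover have "left_act x (insert z S) = insert x (insert z S - {p})"
      using S p \<open>p < z\<close> by (intro left_act_bump) auto
    ultimately show ?thesis using x above \<open>p < z\<close> by auto
  next
    case (bump q)
    have "left_act z (insert x (S - {p})) = insert z (insert x (S - {p}) - {q})"
      using bump s p S \<open>p < z\<close> by (intro left_act_bump) auto
    moreover have "left_act x (insert z (S - {q})) = insert x (insert z (S - {q}) - {p})"
      using S p \<open>p < z\<close> bump by (intro left_act_bump) auto
    ultimately show ?thesis using x bump p s \<open>p < z\<close> by auto
  qed
qed

text \<open>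
  If \<open>S\<close> has no element in the half-open interval from \<open>y\<close> to \<open>z\<close>, both letters expel the same element of \<open>S\<close>, if any.
  After \<open>z\<close> has acted, \<open>y\<close> expels \<open>z\<close> itself, so that \<open>z\<close> leaves no trace.
\<close>

lemma left_act_absorb:
  assumes S: "finite S" and gap: "\<forall>s\<in>S. \<not> (y \<le> s \<and> s < z)" and "y \<le> z"
  shows "left_act y (left_act z S) = left_act y S"
  using S
proof (cases rule: left_act_cases[of S z])
  case above
  then have "left_act y S = insert y S"
    using gap by (intro left_act_above) force
  moreover have "left_act y (insert z S) = insert y (insert z S - {z})"
    using S gap \<open>y \<le> z\<close> by (intro left_act_bump) force+
  ultimately show ?thesis using above by auto
next
  case (bump p)
  have "left_act y S = insert y (S - {p})"
    using S bump gap \<open>y \<le> z\<close> by (intro left_act_bump) force+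
  moreover have "left_act y (insert z (S - {p})) = insert y (insert z (S - {p}) - {z})"
    using S bump gap \<open>y \<le> z\<close> by (intro left_act_bump) force+
  ultimately show ?thesis using bump by auto
qed

text \<open>
  The two Knuth relations of the plactic monoid, \<open>y x z = y z x\<close> for \<open>x < y \<le> z\<close> and
  \<open>x z y = z x y\<close> for \<open>x \<le> y < z\<close>. In the second one, the \<open>y\<close> just placed separates \<open>x\<close> from \<open>z\<close>, so
  they commute. In the first one either such a separating element exists, or \<open>z\<close> leaves no trace
  once \<open>x\<close> or \<open>y\<close> has acted after it.
\<close>

lemma left_act_knuth_yxz:
  assumes S: "finite S" and xyz: "x < y" "y \<le> z"
  shows "left_act y (left_act x (left_act z S)) = left_act y (left_act z (left_act x S))"
proof (cases "\<exists>s\<in>S. x \<le> s \<and> s < z")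
  case True
  then obtain s where "s \<in> S" "x \<le> s" "s < z" by blast
  then show ?thesis using left_act_commute[OF S, of s x z] by simp
next
  case False
  then have "\<forall>s\<in>left_act x S. \<not> (y \<le> s \<and> s < z)"
    using S xyz by (auto simp: mem_left_act_iff)
  then show ?thesis using False S xyz by (simp add: left_act_absorb)
qed

lemma left_act_knuth_xzy:
  assumes "finite S" "x \<le> y" "y < z"
  shows "left_act x (left_act z (left_act y S)) = left_act z (left_act x (left_act y S))"
  using assms left_act_commute[of "left_act y S" y x z] by simp

abbreviation act :: "'a::linorder list \<Rightarrow> 'a set \<Rightarrow> 'a set" where
  "act \<equiv> foldr left_act"

lemma finite_act [simp]: "finite S \<Longrightarrow> finite (act w S)"
  by (induction w) auto

lemma act_mono: "finite T \<Longrightarrow> S \<subseteq> T \<Longrightarrow> act w S \<subseteq> act w T"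
  by (induction w) (simp_all add: left_act_mono)

lemma act_fixed: "finite S \<Longrightarrow> set w \<subseteq> S \<Longrightarrow> act w S = S"
  by (induction w) (auto simp: left_act_fixed)

lemma act_columns:
  assumes "set w \<subseteq> A" "S \<subseteq> A" shows "act w S \<subseteq> A"
  using assms by (induction w) (auto simp: left_act_def split: if_splits)

lemma act_decreasing_empty: "sorted_wrt (>) D \<Longrightarrow> act D {} = set D"
  by (induction D) (auto simp: left_act_above)

text \<open>
  Monotonicity compares the action on \<open>S\<close> with the action on the empty column.
\<close>

lemma set_subset_act:
  assumes "sorted_wrt (>) D" "finite S" shows "set D \<subseteq> act D S"
  using act_mono[of S "{}" D] assms by (simp add: act_decreasing_empty)

lemma act_decreasing_idem: "sorted_wrt (>) D \<Longrightarrow> finite S \<Longrightarrow> act D (act D S) = act D S"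
  by (intro act_fixed set_subset_act) auto

text \<open>
  An element is only ever replaced by a smaller or equal one, so the number of elements up to a
  threshold cannot drop. This count is the monovariant behind \<open>card_act_sandwich\<close>.
\<close>

lemma card_le_left_act:
  assumes "finite S"
  shows "card {s \<in> S. s \<le> t} \<le> card {s \<in> left_act a S. s \<le> t}"
  using assms
proof (cases rule: left_act_cases[of S a])
  case above
  then show ?thesis using assms by (intro card_mono) auto
next
  case (bump p)
  show ?thesis
  proof (cases "p \<le> t")
    case True
    have "a \<notin> S - {p}" using bump by force
    then have "{s \<in> left_act a S. s \<le> t} = insert a ({s \<in> S. s \<le> t} - {p})"
      using bump True by auto
    moreover have "card (insert a ({s \<in> S. s \<le> t} - {p})) = Suc (card ({s \<in> S. s \<le> t} - {p}))"
      using assms \<open>a \<notin> S - {p}\<close> by (intro card_insert_disjoint) auto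
    ultimately show ?thesis using bump True assms by (simp add: card_Suc_Diff1)
  next
    case False
    then show ?thesis using assms bump by (intro card_mono) auto
  qed
qed

lemma card_le_act:
  "finite S \<Longrightarrow> card {s \<in> S. s \<le> t} \<le> card {s \<in> act w S. s \<le> t}"
proof (induction w)
  case (Cons a w)
  then show ?case using card_le_left_act[of "act w S" t a] by simp
qed simp

lemma card_split:
  fixes t :: "'a::linorder"
  assumes "finite S" shows "card S = card {s \<in> S. s \<le> t} + card {s \<in> S. t < s}"
  using card_Int_Diff[of S "{..t}"] assms
  by (simp add: Int_def Diff_eq not_le conj_commute)

lemma card_act:
  assumes "finite S" shows "card S \<le> card (act w S)"
proof -
  (* Every element counts up to this threshold; the arbitrary extra element avoids Max {}. *)
  define t where "t = Max (insert undefined (S \<union> act w S))"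
  have "s \<le> t" if "s \<in> S \<union> act w S" for s
    unfolding t_def using that assms by (intro Max_ge) auto
  then have "{s \<in> S. s \<le> t} = S" "{s \<in> act w S. s \<le> t} = act w S" by auto
  then show ?thesis using card_le_act[OF assms, of t w] by simp
qed

text \<open>
  Starting from the column \<open>D\<close>, the letter \<open>a\<close> raises the number of elements \<open>\<le> a\<close> by one, because
  \<open>a \<notin> D\<close> forces any expelled element to be larger than \<open>a\<close>. Later letters do not lower this number,
  and the final \<open>D\<close> restores all elements of \<open>D\<close> above \<open>a\<close>; together these exceed \<open>|D|\<close>.
\<close>

lemma card_act_sandwich:
  assumes D: "sorted_wrt (>) D" and a: "a \<notin> set D"
  shows "card (set D) < card (act (D @ v @ a # D) {})"
proof -
  define T where "T = act (v @ [a]) (set D)"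
  have fin: "finite T" by (simp add: T_def)
  have "{s \<in> left_act a (set D). s \<le> a} = insert a {s \<in> set D. s \<le> a}"
    using finite_set[of D] a by (auto simp: mem_left_act_iff)
  then have "card {s \<in> set D. s \<le> a} < card {s \<in> left_act a (set D). s \<le> a}"
    using a by simp
  also have "\<dots> \<le> card {s \<in> T. s \<le> a}"
    by (simp add: T_def card_le_act)
  also have "\<dots> \<le> card {s \<in> act D T. s \<le> a}"
    using fin by (rule card_le_act)
  finally have low: "card {s \<in> set D. s \<le> a} < card {s \<in> act D T. s \<le> a}" .
  have high: "card {s \<in> set D. a < s} \<le> card {s \<in> act D T. a < s}"
    using set_subset_act[OF D fin] fin by (intro card_mono) auto
  have "card (set D) < card (act D T)"
    using low high card_split[of "set D" a] card_split[of "act D T" a] fin by simp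
  then show ?thesis by (simp add: T_def act_decreasing_empty[OF D])
qed

text \<open>
  Repeated use of \<open>y x z = y z x\<close>: the letter \<open>c\<close> moves to the left until it stands behind the leading \<open>d\<close>.
\<close>

lemma act_push_right:
  assumes "sorted_wrt (>) (d # D)" "d \<le> c" "finite S"
  shows "act (d # D @ [c]) S = act (d # c # D) S"
  using assms(1,2)
proof (induction D arbitrary: d)
  case (Cons x D)
  have "act (x # D @ [c]) S = act (x # c # D) S"
    using Cons by (intro Cons.IH) auto
  then show ?case using Cons.prems \<open>finite S\<close> left_act_knuth_yxz[of "act D S" x d c] by simp
qed simp

text \<open>
  The letter \<open>c\<close> moves left to its twin in \<open>D\<close> and merges with it by \<open>c c = c\<close>.
\<close>

lemma act_absorb_member:
  assumes "sorted_wrt (>) D" "c \<in> set D" "finite S"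
  shows "act (D @ [c]) S = act D S"
proof -
  obtain D1 D2 where D: "D = D1 @ c # D2" using assms(2) by (meson split_list)
  then have "act (c # D2 @ [c]) S = act (c # D2) S"
    using act_push_right[of c D2 c S] assms by (simp add: sorted_wrt_append left_act_fixed)
  then show ?thesis by (simp add: D)
qed

text \<open>
  A jeu de taquin slide for a column and a single letter, \<open>\<gamma> c = b (\<gamma> \<cdot> c)\<close>. The letter \<open>c\<close> moves left
  up to the first letter \<open>b\<close> smaller than it, by \<open>y x z = y z x\<close>; then \<open>b\<close> moves left through
  the letters larger than \<open>c\<close>, by \<open>x z y = z x y\<close>.
\<close>

lemma act_frank:
  assumes "sorted_wrt (>) D" "c \<notin> set D" "\<exists>x\<in>set D. x < c"
  shows "\<exists>D'. sorted_wrt (>) D' \<and> set D' = insert c (set D - {Max {x \<in> set D. x \<le> c}}) \<and>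
    (\<forall>S. finite S \<longrightarrow> act (D @ [c]) S = act (Max {x \<in> set D. x \<le> c} # D') S)"
  using assms
proof (induction D)
  case (Cons d D)
  consider "d < c" | "c < d" using Cons.prems by force
  then show ?case
  proof cases
    case 1
    have "Max {x \<in> set (d # D). x \<le> c} = d"
      using 1 Cons.prems by (intro Max_eqI) auto
    then show ?thesis
      using 1 Cons.prems by (intro exI[of _ "c # D"]) (auto simp: act_push_right[simplified])
  next
    case 2
    define b where "b = Max {x \<in> set D. x \<le> c}"
    have "{x \<in> set (d # D). x \<le> c} = {x \<in> set D. x \<le> c}" using 2 by auto
    then have b: "Max {x \<in> set (d # D). x \<le> c} = b" by (simp add: b_def)
    obtain D' where D': "sorted_wrt (>) D'" "set D' = insert c (set D - {b})"
      "\<And>S. finite S \<Longrightarrow> act (D @ [c]) S = act (b # D') S"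
      using Cons 2 unfolding b_def by auto
    have "b \<in> {x \<in> set D. x \<le> c}"
      unfolding b_def using Cons.prems 2 by (intro Max_in) auto
    then have bc: "b \<in> set D" "b < c" "b < d" using Cons.prems 2 by (auto simp: less_le)
    obtain e E where E: "D' = e # E" using D' by (cases D') auto
    have "c \<in> insert e (set E)" using D'(2) E by auto
    then have "c \<le> e" using D'(1) E by auto
    have "e < d" using D'(2) E 2 Cons.prems by auto
    have "act ((d # D) @ [c]) S = act (b # d # D') S" if "finite S" for S
      using D'(3)[OF that] left_act_knuth_xzy[of "act E S" b e d] that E \<open>c \<le> e\<close> \<open>e < d\<close> bc by simp
    then show ?thesis unfolding b
      using D' Cons.prems 2 bc by (intro exI[of _ "d # D'"]) auto
  qed
qed simp

section \<open>Monoid algebras\<close>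

lemma frag_extend_fun_diff:
  "frag_extend (\<lambda>u. f u - g u) x = frag_extend f x - frag_extend g x"
  by (rule frag_induction[of x UNIV]) (simp_all add: frag_extend_diff)

lemma monoid_algebra_of_mult_of:
  "frag_of u \<otimes>\<^bsub>monoid_algebra M\<^esub> frag_of v = frag_of (u \<otimes>\<^bsub>M\<^esub> v)"
  by (simp add: monoid_algebra_def)

lemma monoid_algebra_zero_mult: "0 \<otimes>\<^bsub>monoid_algebra M\<^esub> y = 0"
  by (simp add: monoid_algebra_def)

lemma monoid_algebra_mult_zero: "x \<otimes>\<^bsub>monoid_algebra M\<^esub> 0 = 0"
  by (simp add: monoid_algebra_def frag_extend_eq_0)

lemma monoid_algebra_diff_mult:
  "(x - y) \<otimes>\<^bsub>monoid_algebra M\<^esub> z = x \<otimes>\<^bsub>monoid_algebra M\<^esub> z - y \<otimes>\<^bsub>monoid_algebra M\<^esub> z"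
  by (simp add: monoid_algebra_def frag_extend_diff)

lemma monoid_algebra_mult_diff:
  "x \<otimes>\<^bsub>monoid_algebra M\<^esub> (y - z) = x \<otimes>\<^bsub>monoid_algebra M\<^esub> y - x \<otimes>\<^bsub>monoid_algebra M\<^esub> z"
  by (simp add: monoid_algebra_def frag_extend_diff frag_extend_fun_diff)

lemma monoid_algebra_add_mult:
  "(x + y) \<otimes>\<^bsub>monoid_algebra M\<^esub> z = x \<otimes>\<^bsub>monoid_algebra M\<^esub> z + y \<otimes>\<^bsub>monoid_algebra M\<^esub> z"
  by (simp add: monoid_algebra_def frag_extend_add)

lemmas monoid_algebra_linear = monoid_algebra_zero_mult monoid_algebra_mult_zero
  monoid_algebra_diff_mult monoid_algebra_mult_diff monoid_algebra_add_mult

lemma monoid_algebra_carrier_iff: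
  "x \<in> carrier (monoid_algebra M) \<longleftrightarrow> Poly_Mapping.keys x \<subseteq> carrier M"
  by (simp add: monoid_algebra_def)

lemma monoid_algebra_carrier_diff:
  "x \<in> carrier (monoid_algebra M) \<Longrightarrow> y \<in> carrier (monoid_algebra M) \<Longrightarrow>
    x - y \<in> carrier (monoid_algebra M)"
  using keys_diff[of x y] by (auto simp: monoid_algebra_carrier_iff)

lemma monoid_algebra_carrier_of:
  "u \<in> carrier M \<Longrightarrow> frag_of u \<in> carrier (monoid_algebra M)"
  by (simp add: monoid_algebra_carrier_iff)

lemma monoid_algebra_carrier_zero: "0 \<in> carrier (monoid_algebra M)"
  by (simp add: monoid_algebra_carrier_iff)

lemma monoid_algebra_induct [consumes 1, case_names zero of diff]:
  assumes "x \<in> carrier (monoid_algebra M)"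
    and "P 0" "\<And>u. u \<in> carrier M \<Longrightarrow> P (frag_of u)" "\<And>a b. P a \<Longrightarrow> P b \<Longrightarrow> P (a - b)"
  shows "P x"
  using assms by (auto simp: monoid_algebra_carrier_iff intro: frag_induction[of x "carrier M" P])

lemma monoid_monoid_algebra:
  assumes "monoid M"
  shows "monoid (monoid_algebra M)" (is "monoid ?R")
proof -
  interpret M: monoid M by fact
  have one: "\<one>\<^bsub>?R\<^esub> = frag_of \<one>\<^bsub>M\<^esub>" by (simp add: monoid_algebra_def)
  show ?thesis
  proof
    fix x y assume x: "x \<in> carrier ?R" and y: "y \<in> carrier ?R"
    have of_closed: "frag_of u \<otimes>\<^bsub>?R\<^esub> y \<in> carrier ?R" if "u \<in> carrier M" for u
      using y that by (induction rule: monoid_algebra_induct)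
        (simp_all add: monoid_algebra_linear monoid_algebra_of_mult_of monoid_algebra_carrier_diff
          monoid_algebra_carrier_of monoid_algebra_carrier_zero)
    show "x \<otimes>\<^bsub>?R\<^esub> y \<in> carrier ?R"
      using x by (induction rule: monoid_algebra_induct)
        (simp_all add: monoid_algebra_linear monoid_algebra_carrier_diff
          monoid_algebra_carrier_zero of_closed)
    fix z assume z: "z \<in> carrier ?R"
    have of_of_assoc: "(frag_of u \<otimes>\<^bsub>?R\<^esub> frag_of v) \<otimes>\<^bsub>?R\<^esub> z = frag_of u \<otimes>\<^bsub>?R\<^esub> (frag_of v \<otimes>\<^bsub>?R\<^esub> z)"
      if "u \<in> carrier M" "v \<in> carrier M" for u v
      using z that by (induction rule: monoid_algebra_induct)
        (simp_all add: monoid_algebra_linear monoid_algebra_of_mult_of M.m_assoc)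
    have of_assoc: "(frag_of u \<otimes>\<^bsub>?R\<^esub> y) \<otimes>\<^bsub>?R\<^esub> z = frag_of u \<otimes>\<^bsub>?R\<^esub> (y \<otimes>\<^bsub>?R\<^esub> z)"
      if "u \<in> carrier M" for u
      using y that by (induction rule: monoid_algebra_induct)
        (simp_all add: monoid_algebra_linear of_of_assoc)
    show "(x \<otimes>\<^bsub>?R\<^esub> y) \<otimes>\<^bsub>?R\<^esub> z = x \<otimes>\<^bsub>?R\<^esub> (y \<otimes>\<^bsub>?R\<^esub> z)"
      using x by (induction rule: monoid_algebra_induct)
        (simp_all add: monoid_algebra_linear of_assoc)
  next
    fix x assume "x \<in> carrier ?R"
    then show "\<one>\<^bsub>?R\<^esub> \<otimes>\<^bsub>?R\<^esub> x = x" "x \<otimes>\<^bsub>?R\<^esub> \<one>\<^bsub>?R\<^esub> = x"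
      by (induction rule: monoid_algebra_induct)
        (simp_all add: monoid_algebra_linear monoid_algebra_of_mult_of one)
  qed (simp add: one monoid_algebra_carrier_of)
qed

lemma (in monoid) prod_list_ring_closed:
  "set xs \<subseteq> carrier G \<Longrightarrow> prod_list_ring G xs \<in> carrier G"
  by (induction xs) (auto simp: prod_list_ring_def)

lemma (in monoid) prod_list_ring_snoc:
  "set xs \<subseteq> carrier G \<Longrightarrow> x \<in> carrier G \<Longrightarrow>
    prod_list_ring G (xs @ [x]) = prod_list_ring G xs \<otimes> x"
  by (induction xs) (use prod_list_ring_closed in \<open>auto simp: prod_list_ring_def m_assoc\<close>)

section \<open>Words in the stylic monoid\<close>

lemma styl_fun_mult:
  assumes "v \<in> lists A"
  shows "styl_fun A u \<otimes>\<^bsub>Styl A\<^esub> styl_fun A v = styl_fun A (u @ v)"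
proof -
  have "act v \<gamma> \<in> columns A" if "\<gamma> \<in> columns A" for \<gamma>
    using act_columns[of v A \<gamma>] assms that by (auto simp: columns_def)
  then show ?thesis
    by (auto simp: Styl_def styl_fun_def compose_def fun_eq_iff)
qed

lemma monoid_Styl: "monoid (Styl A)"
proof -
  have car: "carrier (Styl A) = styl_fun A ` lists A" by (simp add: Styl_def)
  have one: "\<one>\<^bsub>Styl A\<^esub> = styl_fun A []" by (simp add: Styl_def styl_fun_def)
  have mult: "styl_fun A u \<otimes>\<^bsub>Styl A\<^esub> styl_fun A v = styl_fun A (u @ v)" if "set v \<subseteq> A" for u v
    using that by (intro styl_fun_mult) auto
  show ?thesis
    unfolding lists_eq_set
    by (rule monoidI) (auto simp: car one mult lists_eq_set simp del: append_assoc
        intro!: imageI arg_cong[where f = "styl_fun A"])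
qed

definition word :: "'a::linorder set \<Rightarrow> 'a list \<Rightarrow> ('a set \<Rightarrow> 'a set) \<Rightarrow>\<^sub>0 int" where
  "word A w = frag_of (styl_fun A w)"

lemma word_eqI:
  "finite A \<Longrightarrow> (\<And>S. finite S \<Longrightarrow> act u S = act v S) \<Longrightarrow> word A u = word A v"
  unfolding word_def styl_fun_def columns_def
  by (auto intro!: arg_cong[where f = frag_of] restrict_ext simp: finite_subset)

context
  fixes A :: "'a::linorder set"
  assumes finite_A: "finite A"
begin

interpretation R: monoid "ZStyl A"
  unfolding ZStyl_def by (intro monoid_monoid_algebra monoid_Styl)

abbreviation styl_mult (infixl "\<star>" 70) where "x \<star> y \<equiv> x \<otimes>\<^bsub>ZStyl A\<^esub> y"

lemmas linear = monoid_algebra_linear[of "Styl A", folded ZStyl_def]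

lemma carrier_diff: "x \<in> carrier (ZStyl A) \<Longrightarrow> y \<in> carrier (ZStyl A) \<Longrightarrow> x - y \<in> carrier (ZStyl A)"
  unfolding ZStyl_def by (rule monoid_algebra_carrier_diff)

lemma word_closed: "w \<in> lists A \<Longrightarrow> word A w \<in> carrier (ZStyl A)"
  unfolding word_def ZStyl_def by (intro monoid_algebra_carrier_of) (auto simp: Styl_def)

lemma word_mult: "v \<in> lists A \<Longrightarrow> word A u \<star> word A v = word A (u @ v)"
  by (simp add: word_def ZStyl_def monoid_algebra_of_mult_of styl_fun_mult)

lemma word_Nil: "word A [] = \<one>\<^bsub>ZStyl A\<^esub>"
  by (simp add: word_def ZStyl_def monoid_algebra_def Styl_def styl_fun_def)

lemma letter_eq_word: "letter A a = word A [a]"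
  by (simp add: letter_def word_def)

lemma letter_closed: "a \<in> A \<Longrightarrow> letter A a \<in> carrier (ZStyl A)"
  by (simp add: letter_eq_word word_closed)

lemma letter_mult_word: "w \<in> lists A \<Longrightarrow> letter A a \<star> word A w = word A (a # w)"
  by (simp add: letter_eq_word word_mult)

lemma prod_letters: "w \<in> lists A \<Longrightarrow> prod_list_ring (ZStyl A) (map (letter A) w) = word A w"
  by (induction w) (simp_all add: prod_list_ring_def word_Nil letter_mult_word)

definition one_minus_prod :: "'a list \<Rightarrow> ('a set \<Rightarrow> 'a set) \<Rightarrow>\<^sub>0 int" where
  "one_minus_prod L = prod_list_ring (ZStyl A) (map (\<lambda>a. \<one>\<^bsub>ZStyl A\<^esub> - letter A a) L)"

lemma one_minus_letter_closed: "a \<in> A \<Longrightarrow> \<one>\<^bsub>ZStyl A\<^esub> - letter A a \<in> carrier (ZStyl A)"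
  by (simp add: carrier_diff letter_closed)

lemma one_minus_prod_closed: "set L \<subseteq> A \<Longrightarrow> one_minus_prod L \<in> carrier (ZStyl A)"
  unfolding one_minus_prod_def by (intro R.prod_list_ring_closed) (auto simp: one_minus_letter_closed)

lemma one_minus_prod_Cons: "one_minus_prod (a # L) = (\<one>\<^bsub>ZStyl A\<^esub> - letter A a) \<star> one_minus_prod L"
  by (simp add: one_minus_prod_def prod_list_ring_def)

lemma one_minus_prod_snoc:
  "set L \<subseteq> A \<Longrightarrow> a \<in> A \<Longrightarrow> one_minus_prod (L @ [a]) = one_minus_prod L \<star> (\<one>\<^bsub>ZStyl A\<^esub> - letter A a)"
  unfolding one_minus_prod_def map_append list.map
  by (intro R.prod_list_ring_snoc) (auto intro!: one_minus_letter_closed)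

definition col_word :: "'a set \<Rightarrow> 'a list" where
  "col_word \<gamma> = rev (sorted_list_of_set \<gamma>)"

lemma col_word [simp]:
  assumes "\<gamma> \<subseteq> A" shows "set (col_word \<gamma>) = \<gamma>" "sorted_wrt (>) (col_word \<gamma>)" "col_word \<gamma> \<in> lists A"
  using assms finite_subset[OF assms finite_A]
  by (auto simp: col_word_def sorted_wrt_rev)

lemma col_word_unique: "sorted_wrt (>) D \<Longrightarrow> col_word (set D) = D"
  unfolding col_word_def
  by (metis List.finite_set finite_sorted_distinct_unique rev_rev_ident set_rev
      sorted_list_of_set.idem_if_sorted_distinct sorted_wrt_rev strict_sorted_iff)

abbreviation col_prefix :: "'a set \<Rightarrow> ('a set \<Rightarrow> 'a set) \<Rightarrow>\<^sub>0 int" where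
  "col_prefix \<gamma> \<equiv> one_minus_prod (sorted_list_of_set (A - \<gamma>))"

lemma prefix_closed: "col_prefix \<gamma> \<in> carrier (ZStyl A)"
  using finite_A by (intro one_minus_prod_closed) auto

lemma col_elt_eq: "\<gamma> \<subseteq> A \<Longrightarrow> col_elt A \<gamma> = col_prefix \<gamma> \<star> word A (col_word \<gamma>)"
  using col_word[of \<gamma>] by (simp add: col_elt_def one_minus_prod_def prod_letters flip: col_word_def)

lemma col_elt_closed: "\<gamma> \<subseteq> A \<Longrightarrow> col_elt A \<gamma> \<in> carrier (ZStyl A)"
  by (simp add: col_elt_eq prefix_closed word_closed)

section \<open>The column elements sum to one\<close>

text \<open>
  The alphabet varies while the ambient algebra stays fixed, so that one can induct by adding a new
  largest letter \<open>n\<close>. It stands last in the increasing product and first in the decreasing one.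
\<close>

lemma sum_over_subsets_eq_one:
  "finite B \<Longrightarrow> B \<subseteq> A \<Longrightarrow>
    (\<Sum>\<gamma>\<in>Pow B. one_minus_prod (sorted_list_of_set (B - \<gamma>)) \<star> word A (col_word \<gamma>)) = \<one>\<^bsub>ZStyl A\<^esub>"
proof (induction B rule: finite_linorder_max_induct)
  case empty
  show ?case by (simp add: one_minus_prod_def prod_list_ring_def col_word_def word_Nil)
next
  case (insert n B)
  let ?e = "\<lambda>B \<gamma>. one_minus_prod (sorted_list_of_set (B - \<gamma>)) \<star> word A (col_word \<gamma>)"
  have n: "n \<in> A" "n \<notin> B" and B: "B \<subseteq> A" "finite B" using insert by auto
  have slos: "sorted_list_of_set (insert n X) = sorted_list_of_set X @ [n]" if "X \<subseteq> B" for X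
    using that insert finite_subset[OF that B(2)]
    by (intro sorted_list_of_set_unique[THEN iffD1])
      (auto simp: sorted_wrt_append subset_iff card_insert_if)
  have step: "?e (insert n B) \<gamma> + ?e (insert n B) (insert n \<gamma>) = ?e B \<gamma>" if "\<gamma> \<in> Pow B" for \<gamma>
  proof -
    let ?P = "one_minus_prod (sorted_list_of_set (B - \<gamma>))" and ?w = "word A (col_word \<gamma>)"
    have \<gamma>: "\<gamma> \<subseteq> A" "\<gamma> \<subseteq> B" using that B by auto
    have P: "?P \<in> carrier (ZStyl A)" and w: "?w \<in> carrier (ZStyl A)"
      using \<gamma> B by (auto intro!: one_minus_prod_closed word_closed)
    have "insert n B - \<gamma> = insert n (B - \<gamma>)" "insert n B - insert n \<gamma> = B - \<gamma>"
      using n \<gamma> by auto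
    moreover have "one_minus_prod (sorted_list_of_set (insert n (B - \<gamma>))) = ?P \<star> (\<one>\<^bsub>ZStyl A\<^esub> - letter A n)"
      using n B by (subst slos) (auto intro!: one_minus_prod_snoc)
    moreover have "word A (col_word (insert n \<gamma>)) = letter A n \<star> ?w"
      using \<gamma> slos[of \<gamma>] col_word[of \<gamma>] by (simp add: col_word_def letter_mult_word)
    ultimately show ?thesis
      using P w n by (simp add: linear R.m_assoc letter_closed)
  qed
  have "inj_on (insert n) (Pow B)" "Pow B \<inter> insert n ` Pow B = {}"
    using n by (auto simp: inj_on_def insert_ident)
  then have "(\<Sum>\<gamma>\<in>Pow (insert n B). ?e (insert n B) \<gamma>)
      = (\<Sum>\<gamma>\<in>Pow B. ?e (insert n B) \<gamma>) + (\<Sum>\<gamma>\<in>Pow B. ?e (insert n B) (insert n \<gamma>))"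
    unfolding Pow_insert using B
    by (subst sum.union_disjoint) (simp_all add: sum.reindex del: insert_Diff1 Diff_insert0)
  also have "\<dots> = (\<Sum>\<gamma>\<in>Pow B. ?e B \<gamma>)"
    using step by (simp add: sum.distrib[symmetric])
  finally show ?case using insert B by simp
qed

lemma sum_col_elt: "(\<Sum>\<gamma>\<in>columns A. col_elt A \<gamma>) = \<one>\<^bsub>ZStyl A\<^esub>"
  using sum_over_subsets_eq_one[OF finite_A] by (simp add: columns_def col_elt_eq)

section \<open>Words killed by the products of the \<open>1 - a\<close>\<close>

text \<open>
  Since \<open>a b a = b a\<close> for \<open>a < b\<close>: the letter \<open>b\<close> never expels the smaller \<open>a\<close>.
\<close>

lemma fixed_by_letter_step:
  assumes "a \<in> A" "b \<in> A" "a < b" "y \<in> carrier (ZStyl A)" "letter A a \<star> y = y"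
  shows "letter A a \<star> ((\<one>\<^bsub>ZStyl A\<^esub> - letter A b) \<star> y) = (\<one>\<^bsub>ZStyl A\<^esub> - letter A b) \<star> y"
proof -
  have "word A [a, b, a] = word A [b, a]"
    using \<open>a < b\<close> by (intro word_eqI finite_A) (simp add: left_act_fixed mem_left_act_iff)
  then have "letter A a \<star> (letter A b \<star> letter A a) = letter A b \<star> letter A a"
    using assms by (simp add: letter_eq_word word_mult)
  then have "letter A a \<star> (letter A b \<star> y) = letter A b \<star> y"
    using assms by (metis R.m_assoc R.m_closed letter_closed)
  then show ?thesis using assms by (simp add: linear)
qed

text \<open>
  The factors to the right of \<open>1 - a\<close> involve letters larger than \<open>a\<close>, so they preserve the property of
  being fixed by \<open>a\<close>, and \<open>1 - a\<close> then gives \<open>0\<close>.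
\<close>

lemma one_minus_prod_vanish:
  assumes "sorted_wrt (<) L" "set L \<subseteq> A" "a \<in> set L" "y \<in> carrier (ZStyl A)" "letter A a \<star> y = y"
  shows "one_minus_prod L \<star> y = 0"
  using assms
proof (induction L)
  case (Cons b L)
  have L: "one_minus_prod L \<in> carrier (ZStyl A)" and b: "b \<in> A" using Cons.prems by (auto intro: one_minus_prod_closed)
  have eq: "one_minus_prod (b # L) \<star> y = (\<one>\<^bsub>ZStyl A\<^esub> - letter A b) \<star> (one_minus_prod L \<star> y)"
    using L b Cons.prems by (simp add: one_minus_prod_Cons R.m_assoc one_minus_letter_closed)
  show ?case
  proof (cases "a \<in> set L")
    case True
    then show ?thesis using Cons eq by (simp add: linear)
  next
    case False
    then have a: "a = b" using Cons.prems by simp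
    have "letter A a \<star> (one_minus_prod M \<star> y) = one_minus_prod M \<star> y" if "\<forall>c\<in>set M. a < c" "set M \<subseteq> A" for M
      using that
    proof (induction M)
      case Nil
      then show ?case using Cons.prems by (simp add: one_minus_prod_def prod_list_ring_def)
    next
      case (Cons c M)
      have "one_minus_prod (c # M) \<star> y = (\<one>\<^bsub>ZStyl A\<^esub> - letter A c) \<star> (one_minus_prod M \<star> y)"
        using Cons.prems assms(4) one_minus_prod_closed[of M]
        by (simp add: one_minus_prod_Cons R.m_assoc one_minus_letter_closed)
      then show ?case
        using Cons a b assms(4) one_minus_prod_closed[of M] by (auto intro!: fixed_by_letter_step)
    qed
    from this[of L] have "letter A b \<star> (one_minus_prod L \<star> y) = one_minus_prod L \<star> y"
      using Cons.prems a by simp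
    then show ?thesis unfolding eq using L Cons.prems by (simp add: linear)
  qed
qed simp

lemma prefix_word_eq_0:
  assumes w: "w \<in> lists A" and "\<not> act w {} \<subseteq> \<gamma>"
  shows "col_prefix \<gamma> \<star> word A w = 0"
proof -
  obtain a where a: "a \<in> act w {}" "a \<notin> \<gamma>" using assms by blast
  have "a \<in> A" using a act_columns[of w A "{}"] w by auto
  have "left_act a (act w S) = act w S" if "finite S" for S
    using act_mono[of S "{}" w] a that by (intro left_act_fixed) auto
  then have "letter A a \<star> word A w = word A w"
    using w by (simp add: letter_mult_word) (intro word_eqI finite_A, simp)
  then show ?thesis
    using a \<open>a \<in> A\<close> finite_A w
    by (intro one_minus_prod_vanish[of _ a]) (auto intro: word_closed)
qed

lemma prefix_long_word_eq_0:
  assumes "w \<in> lists A" "\<gamma> \<subseteq> A" "card \<gamma> < card (act w {})"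
  shows "col_prefix \<gamma> \<star> word A w = 0"
  using assms card_mono[of \<gamma> "act w {}"] finite_subset[OF _ finite_A]
  by (intro prefix_word_eq_0) (auto simp: not_le[symmetric])

section \<open>Multiplying a column element by a letter\<close>

lemma col_elt_member:
  assumes "\<gamma> \<subseteq> A" "c \<in> \<gamma>"
  shows "col_elt A \<gamma> \<star> letter A c = col_elt A \<gamma>"
proof -
  have "word A (col_word \<gamma> @ [c]) = word A (col_word \<gamma>)"
    using assms by (intro word_eqI finite_A act_absorb_member) auto
  then have "word A (col_word \<gamma>) \<star> letter A c = word A (col_word \<gamma>)"
    using assms by (simp add: letter_eq_word word_mult subset_iff)
  then show ?thesis
    using assms by (auto simp: col_elt_eq R.m_assoc prefix_closed word_closed letter_closed subset_iff)
qed

text \<open>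
  Appending \<open>c\<close> to the word of \<open>\<gamma>\<close> gives the word of a larger column, which \<open>P\<^sub>\<gamma>\<close> kills.
\<close>

lemma col_elt_below:
  assumes "\<gamma> \<subseteq> A" "c \<in> A" "\<forall>x\<in>\<gamma>. c < x"
  shows "col_elt A \<gamma> \<star> letter A c = 0"
proof -
  have "sorted_wrt (>) (col_word \<gamma> @ [c])"
    using assms by (simp add: sorted_wrt_append)
  then have "act (col_word \<gamma> @ [c]) {} = insert c \<gamma>"
    using assms by (subst act_decreasing_empty) auto
  moreover have "c \<notin> \<gamma>" using assms by auto
  ultimately have "col_prefix \<gamma> \<star> word A (col_word \<gamma> @ [c]) = 0"
    using assms by (intro prefix_word_eq_0) auto
  then show ?thesis
    using assms by (simp add: col_elt_eq R.m_assoc prefix_closed word_closed letter_closed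
        word_mult letter_eq_word)
qed

text \<open>
  With \<open>\<delta> = \<gamma> \<cdot> c\<close> the left side is \<open>P\<^sub>\<gamma> b \<delta>\<close>. Multiplying it by \<open>P\<^sub>\<delta>\<close> and then by \<open>\<delta>\<close>, every term that
  picks a letter from some factor \<open>1 - a\<close> contains a word \<open>\<delta> v a \<delta>\<close> with \<open>a \<notin> \<delta>\<close>, hence is killed by \<open>P\<^sub>\<gamma>\<close>.
\<close>

lemma col_elt_frank:
  assumes "\<gamma> \<subseteq> A" "c \<in> A" "frank \<gamma> c"
  shows "col_elt A \<gamma> \<star> letter A c = col_elt A \<gamma> \<star> (letter A c \<star> col_elt A (right_act \<gamma> c))"
proof -
  define \<delta> where "\<delta> = right_act \<gamma> c"
  define b where "b = Max {x \<in> \<gamma>. x \<le> c}"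
  have fin: "finite \<gamma>" using assms finite_A finite_subset by blast
  have c: "c \<notin> \<gamma>" "\<exists>x\<in>\<gamma>. x < c"
    using assms(3) Min_in[OF fin] by (auto simp: frank_def order_le_less)
  then have \<delta>_eq: "\<delta> = insert c (\<gamma> - {b})"
    unfolding \<delta>_def b_def right_act_def by force
  have "b \<in> {x \<in> \<gamma>. x \<le> c}"
    unfolding b_def using c fin by (intro Max_in) auto
  then have b: "b \<in> \<gamma>" "b \<in> A" using assms by auto
  have \<delta>: "\<delta> \<subseteq> A" "card \<delta> = card \<gamma>"
    using \<delta>_eq b c fin assms card_Suc_Diff1[OF fin b(1)] by auto
  obtain D where "sorted_wrt (>) D" "set D = \<delta>"
    and "\<And>S. finite S \<Longrightarrow> act (col_word \<gamma> @ [c]) S = act (b # D) S"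
    using act_frank[of "col_word \<gamma>" c] assms c unfolding b_def \<delta>_eq by auto
  then have shift: "word A (col_word \<gamma> @ [c]) = word A (b # col_word \<delta>)"
    using col_word_unique[of D] by (intro word_eqI finite_A) auto
  have vanish: "col_prefix \<gamma> \<star> word A (b # col_word \<delta> @ v @ a # col_word \<delta>) = 0"
    if "v \<in> lists A" "a \<in> A - \<delta>" for v a
  proof (rule prefix_long_word_eq_0)
    let ?w = "col_word \<delta> @ v @ a # col_word \<delta>"
    have "card \<gamma> < card (act ?w {})"
      using card_act_sandwich[of "col_word \<delta>" a v] \<delta> that by simp
    also have "\<dots> \<le> card (act (b # ?w) {})"
      using card_act[of "act ?w {}" "[b]"] by simp
    finally show "card \<gamma> < card (act (b # ?w) {})" .
  qed (use that b \<delta> assms in auto)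
  (* The word v collects the letters that the expansion has already picked. *)
  have expand: "(col_prefix \<gamma> \<star> word A (b # col_word \<delta> @ v)) \<star> (one_minus_prod L \<star> word A (col_word \<delta>))
      = col_prefix \<gamma> \<star> word A (b # col_word \<delta> @ v @ col_word \<delta>)"
    if "set L \<subseteq> A - \<delta>" "v \<in> lists A" for L v
    using that
  proof (induction L arbitrary: v)
    case Nil
    have "one_minus_prod [] = \<one>\<^bsub>ZStyl A\<^esub>" by (simp add: one_minus_prod_def prod_list_ring_def)
    then show ?case
      using Nil b \<delta> by (simp add: prefix_closed word_closed R.m_assoc word_mult)
  next
    case (Cons a L)
    have a: "a \<in> A - \<delta>" and L: "one_minus_prod L \<in> carrier (ZStyl A)"
      using Cons.prems by (auto intro: one_minus_prod_closed)
    let ?u = "\<lambda>v. col_prefix \<gamma> \<star> word A (b # col_word \<delta> @ v)"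
      and ?y = "one_minus_prod L \<star> word A (col_word \<delta>)"
    have closed: "?u v \<in> carrier (ZStyl A)" "?y \<in> carrier (ZStyl A)"
      using Cons.prems b \<delta> L by (auto intro!: R.m_closed prefix_closed word_closed)
    have "?u v \<star> (one_minus_prod (a # L) \<star> word A (col_word \<delta>)) = ?u v \<star> ?y - ?u v \<star> (letter A a \<star> ?y)"
      using closed a L \<delta>
      by (simp add: one_minus_prod_Cons linear R.m_assoc word_closed letter_closed)
    also have "?u v \<star> (letter A a \<star> ?y) = ?u (v @ [a]) \<star> ?y"
      using closed a b \<delta> Cons.prems
      by (simp add: letter_closed word_closed prefix_closed word_mult letter_eq_word
          flip: R.m_assoc) (simp add: R.m_assoc prefix_closed word_closed word_mult)
    also have "?u (v @ [a]) \<star> ?y = 0"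
      using Cons.IH[of "v @ [a]"] Cons.prems a vanish[of v a] by simp
    also have "?u v \<star> ?y = ?u (v @ col_word \<delta>)"
      using Cons by simp
    finally show ?case by simp
  qed
  have idem: "word A (b # col_word \<delta> @ col_word \<delta>) = word A (b # col_word \<delta>)"
    using \<delta> by (intro word_eqI finite_A) (simp add: act_decreasing_idem)
  have left: "col_elt A \<gamma> \<star> letter A c = col_prefix \<gamma> \<star> word A (b # col_word \<delta>)"
    using assms shift by (simp add: col_elt_eq R.m_assoc prefix_closed word_closed letter_eq_word word_mult)
  have "col_elt A \<gamma> \<star> (letter A c \<star> col_elt A \<delta>) = (col_elt A \<gamma> \<star> letter A c) \<star> col_elt A \<delta>"
    using assms \<delta> by (simp add: R.m_assoc col_elt_closed letter_closed)
  also have "\<dots> = col_prefix \<gamma> \<star> word A (b # col_word \<delta> @ col_word \<delta>)"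
    unfolding left using \<delta> expand[of "sorted_list_of_set (A - \<delta>)" "[]"] finite_A
    by (simp add: col_elt_eq)
  also have "\<dots> = col_elt A \<gamma> \<star> letter A c"
    by (simp add: idem left)
  finally show ?thesis by (simp add: \<delta>_def)
qed

section \<open>The span of the walks\<close>

lemma right_act_subset: "\<gamma> \<subseteq> A \<Longrightarrow> c \<in> A \<Longrightarrow> right_act \<gamma> c \<subseteq> A"
  by (auto simp: right_act_def split: if_splits)

lemma quiver_map_walk_closed:
  "is_walk (quiver_edges A) \<gamma> es \<Longrightarrow> \<gamma> \<subseteq> A \<Longrightarrow> quiver_map_walk A \<gamma> es \<in> carrier (ZStyl A)"
proof (induction es arbitrary: \<gamma>)
  case Nil
  then show ?case by (simp add: col_elt_closed)
next
  case (Cons e es)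
  obtain c where "e = (\<gamma>, c, right_act \<gamma> c)" "c \<in> A"
    using Cons.prems by (cases e) (auto simp: quiver_edges_def)
  then show ?case
    using Cons right_act_subset[of \<gamma> c]
    by (auto intro!: R.m_closed col_elt_closed letter_closed Cons.IH)
qed

text \<open>
  Fixing the start vertex is what makes the induction in \<open>col_elt_word_in_walk_span\<close> work: a walk from
  \<open>\<gamma> \<cdot> c\<close> can be prolonged by the edge that leads from \<open>\<gamma>\<close> to it.
\<close>

definition walk_span :: "'a set \<Rightarrow> (('a set \<Rightarrow> 'a set) \<Rightarrow>\<^sub>0 int) set" where
  "walk_span \<gamma> = quiver_map A ` {x. Poly_Mapping.keys x \<subseteq> {\<gamma>} \<times> {es. is_walk (quiver_edges A) \<gamma> es}}"

lemma quiver_map_0: "quiver_map A 0 = 0"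
  and quiver_map_diff: "quiver_map A (x - y) = quiver_map A x - quiver_map A y"
  and quiver_map_of: "quiver_map A (frag_of (\<gamma>, es)) = quiver_map_walk A \<gamma> es"
  by (simp_all add: quiver_map_def frag_extend_diff)

lemma walk_span_0: "0 \<in> walk_span \<gamma>"
  unfolding walk_span_def by (intro image_eqI[of _ _ 0]) (simp_all add: quiver_map_0)

lemma walk_span_diff: "x \<in> walk_span \<gamma> \<Longrightarrow> y \<in> walk_span \<gamma> \<Longrightarrow> x - y \<in> walk_span \<gamma>"
proof -
  assume "x \<in> walk_span \<gamma>" "y \<in> walk_span \<gamma>"
  then obtain p q where pq: "x = quiver_map A p" "y = quiver_map A q"
      "Poly_Mapping.keys p \<union> Poly_Mapping.keys q \<subseteq> {\<gamma>} \<times> {es. is_walk (quiver_edges A) \<gamma> es}"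
    by (auto simp: walk_span_def)
  then show ?thesis
    unfolding walk_span_def pq(1,2) quiver_map_diff[symmetric]
    using keys_diff[of p q] by (intro imageI) blast
qed

lemma walk_in_walk_span: "is_walk (quiver_edges A) \<gamma> es \<Longrightarrow> quiver_map_walk A \<gamma> es \<in> walk_span \<gamma>"
  unfolding walk_span_def quiver_map_of[symmetric] by (intro imageI) auto

lemma walk_span_edge:
  assumes "\<gamma> \<subseteq> A" "c \<in> A" "frank \<gamma> c" "y \<in> walk_span (right_act \<gamma> c)"
  shows "col_elt A \<gamma> \<star> (letter A c \<star> y) \<in> walk_span \<gamma>"
proof -
  let ?\<delta> = "right_act \<gamma> c"
  obtain x where x: "Poly_Mapping.keys x \<subseteq> {?\<delta>} \<times> {es. is_walk (quiver_edges A) ?\<delta> es}"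
    and y: "y = quiver_map A x" using assms(4) by (auto simp: walk_span_def)
  show ?thesis unfolding y using x
  proof (induction x rule: frag_induction)
    case (one p)
    then obtain es where p: "p = (?\<delta>, es)" "is_walk (quiver_edges A) ?\<delta> es" by auto
    then have "is_walk (quiver_edges A) \<gamma> ((\<gamma>, c, ?\<delta>) # es)"
      using assms by (simp add: quiver_edges_def columns_def)
    from walk_in_walk_span[OF this] show ?case by (simp add: p quiver_map_of)
  qed (simp_all add: quiver_map_0 quiver_map_diff linear walk_span_0 walk_span_diff)
qed

text \<open>
  The first letter \<open>c\<close> of the word is absorbed by \<open>e\<^sub>\<gamma>\<close>, kills it, or is the label of an edge leaving \<open>\<gamma>\<close>.
\<close>

lemma col_elt_word_in_walk_span:
  "w \<in> lists A \<Longrightarrow> \<gamma> \<subseteq> A \<Longrightarrow> col_elt A \<gamma> \<star> word A w \<in> walk_span \<gamma>"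
proof (induction w arbitrary: \<gamma>)
  case Nil
  then show ?case
    using walk_in_walk_span[of \<gamma> "[]"] by (simp add: word_Nil col_elt_closed)
next
  case (Cons c w)
  have c: "c \<in> A" and w: "w \<in> lists A" using Cons.prems by auto
  have fin: "finite \<gamma>" using Cons.prems finite_A finite_subset by blast
  have eq: "col_elt A \<gamma> \<star> word A (c # w) = (col_elt A \<gamma> \<star> letter A c) \<star> word A w"
    using c w Cons.prems by (simp add: R.m_assoc col_elt_closed letter_closed word_closed letter_mult_word)
  consider "c \<in> \<gamma>" | "\<forall>x\<in>\<gamma>. c < x" | "frank \<gamma> c"
  proof (cases "c \<in> \<gamma> \<or> (\<forall>x\<in>\<gamma>. c < x)")
    case False
    then obtain x where "x \<in> \<gamma>" "x \<le> c" by (auto simp: not_less)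
    then have "frank \<gamma> c"
      using False Min_le[OF fin, of x] by (auto simp: frank_def)
    then show ?thesis using that by blast
  qed (use that in blast)
  then show ?case
  proof cases
    case 1
    then show ?thesis using Cons w by (simp add: eq col_elt_member)
  next
    case 2
    then show ?thesis using Cons.prems c by (simp add: eq col_elt_below linear walk_span_0)
  next
    case 3
    have \<delta>: "right_act \<gamma> c \<subseteq> A" using Cons.prems c by (simp add: right_act_subset)
    have "col_elt A \<gamma> \<star> word A (c # w)
        = col_elt A \<gamma> \<star> (letter A c \<star> (col_elt A (right_act \<gamma> c) \<star> word A w))"
      unfolding eq using 3 \<delta> Cons.prems c w
      by (subst col_elt_frank) (simp_all add: R.m_assoc col_elt_closed letter_closed word_closed)
    then show ?thesis using walk_span_edge 3 Cons.prems c Cons.IH[OF w \<delta>] by simp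
  qed
qed

lemma walk_span_subset_image: "\<gamma> \<subseteq> A \<Longrightarrow> walk_span \<gamma> \<subseteq> quiver_map A ` carrier (ZQ A)"
  unfolding walk_span_def
  by (intro image_mono) (auto simp: ZQ_def path_algebra_def paths_def columns_def)

lemma quiver_map_closed:
  assumes "x \<in> carrier (ZQ A)" shows "quiver_map A x \<in> carrier (ZStyl A)"
proof -
  have "Poly_Mapping.keys x \<subseteq> paths (columns A) (quiver_edges A)"
    using assms by (simp add: ZQ_def path_algebra_def)
  then show ?thesis
  proof (induction x rule: frag_induction)
    case zero
    then show ?case by (simp add: quiver_map_0 ZStyl_def monoid_algebra_carrier_zero)
  next
    case (one p)
    then show ?case
      by (auto simp: paths_def columns_def quiver_map_of intro: quiver_map_walk_closed)
  next
    case (diff x y)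
    then show ?case by (simp add: quiver_map_diff carrier_diff)
  qed
qed

lemma image_diff_closed:
  assumes "x \<in> quiver_map A ` carrier (ZQ A)" "y \<in> quiver_map A ` carrier (ZQ A)"
  shows "x - y \<in> quiver_map A ` carrier (ZQ A)"
proof -
  obtain p q where pq: "x = quiver_map A p" "y = quiver_map A q"
      "p \<in> carrier (ZQ A)" "q \<in> carrier (ZQ A)"
    using assms by auto
  then have "p - q \<in> carrier (ZQ A)"
    using keys_diff[of p q] by (auto simp: ZQ_def path_algebra_def)
  then show ?thesis unfolding pq(1,2) quiver_map_diff[symmetric] by (rule imageI)
qed

text \<open>
  Every word \<open>w\<close> is the sum of the \<open>e\<^sub>\<gamma> w\<close>, each of which lies in the span of the walks from \<open>\<gamma>\<close>.
\<close>

lemma carrier_subset_image: "carrier (ZStyl A) \<subseteq> quiver_map A ` carrier (ZQ A)"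
proof
  let ?I = "quiver_map A ` carrier (ZQ A)"
  have zero: "0 \<in> ?I"
    using walk_span_0[of "{}"] walk_span_subset_image[of "{}"] by auto
  have add: "x + y \<in> ?I" if "x \<in> ?I" "y \<in> ?I" for x y
    using image_diff_closed[OF that(1) image_diff_closed[OF zero that(2)]] by simp
  fix x assume "x \<in> carrier (ZStyl A)"
  then show "x \<in> ?I"
    unfolding ZStyl_def
  proof (induction rule: monoid_algebra_induct)
    case zero
    then show ?case by (rule \<open>0 \<in> ?I\<close>)
  next
    case (of u)
    then obtain w where w: "w \<in> lists A" "frag_of u = word A w"
      by (auto simp: Styl_def word_def)
    have "(\<Sum>\<gamma>\<in>C. col_elt A \<gamma>) \<star> word A w \<in> ?I" if "finite C" "C \<subseteq> columns A" for C
      using that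
    proof (induction C rule: finite_induct)
      case empty
      then show ?case using zero by (simp add: linear)
    next
      case (insert \<gamma> C)
      then show ?case
        using col_elt_word_in_walk_span[OF w(1), of \<gamma>] walk_span_subset_image[of \<gamma>]
        by (auto simp: linear columns_def intro!: add)
    qed
    from this[of "columns A"] show ?case
      unfolding sum_col_elt using finite_A w by (simp add: columns_def word_closed)
  next
    case (diff a b)
    then show ?case by (rule image_diff_closed)
  qed
qed

end

theorem corollary4p12:
  fixes A :: "'a::linorder set"
  assumes "finite A"
  shows "quiver_map A ` carrier (ZQ A) = carrier (ZStyl A)"
  using carrier_subset_image[OF assms] quiver_map_closed[OF assms] by blast

end
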